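(* Let $\kappa$ be a regular uncountable cardinal and let $\lambda = |2^{<\kappa}|$. There are functions $\Phi_- : \kappa^\lambda \to \mathcal{NWD}_\kappa$ and $\Phi_+ : \mathcal{M}_\kappa \to [\kappa^\lambda]^{\lambda}$ such that whenever $A \in \mathcal{M}_\kappa$ and $g \in \kappa^\lambda$ is not eventually bounded by $\Phi_+(A)$ (i.e. there is no $f \in \Phi_+(A)$ with $g \leq^* f$), then $\Phi_-(g) \not\subseteq A$.
   Context: $2^{<\kappa} = \bigcup_{\alpha<\kappa} 2^\alpha$ is the set of binary sequences of length $<\kappa$. The higher Cantor space $2^\kappa$ carries the $\kappa$-box topology, whose basic clopen sets are $[\sigma] = \{ f \in 2^\kappa : \sigma \subseteq f\}$ for $\sigma \in 2^{<\kappa}$. A set $A \subseteq 2^\kappa$ is nowhere dense if for every $\sigma \in 2^{<\kappa}$ there is $\tau \supseteq \sigma$ with $[\tau] \cap A = \emptyset$; $\mathcal{NWD}_\kappa$ is the family of nowhere dense subsets of $2^\kappa$. A set is $\kappa$-meager if it is a union of at most $\kappa$ nowhere dense sets; $\mathcal{M}_\kappa$ is the ideal of $\kappa$-meager sets. For $f,g \in \kappa^\lambda$, $f \leq^* g$ means $|\{\gamma<\lambda : f(\gamma) > g(\gamma)\}| < \kappa$. $[\kappa^\lambda]^\lambda$ denotes the family of subsets of $\kappa^\lambda$ of cardinality $\lambda$. *)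

theory Defs
  imports Main "HOL-Library.FuncSet"
begin

unbundle cardinal_syntax

text \<open>
  A cardinal is a well-order of type \<open>'a rel\<close> satisfying \<open>Card_order\<close>, and its ordinals are the
  elements of its field. The sequence space $2^\kappa$ and the binary sequences of length below
  $\kappa$ are both sets of partial maps, so that a sequence determines its length (its domain) and
  extension of sequences is \<open>map_le\<close>.
\<close>

definition binseqs :: "'a set \<Rightarrow> ('a \<rightharpoonup> bool) set" where
  "binseqs D = {s. dom s = D}"

definition cantor_space :: "'a rel \<Rightarrow> ('a \<rightharpoonup> bool) set" where
  "cantor_space \<kappa> = binseqs (Field \<kappa>)"

text \<open>The ordinal \<open>\<alpha> < \<kappa>\<close> is, as a set, the initial segment \<open>underS \<kappa> \<alpha>\<close>.\<close>

definition short_binseqs :: "'a rel \<Rightarrow> ('a \<rightharpoonup> bool) set" where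
  "short_binseqs \<kappa> = (\<Union>\<alpha>\<in>Field \<kappa>. binseqs (underS \<kappa> \<alpha>))"

definition basic_clopen :: "'a rel \<Rightarrow> ('a \<rightharpoonup> bool) \<Rightarrow> ('a \<rightharpoonup> bool) set" where
  "basic_clopen \<kappa> \<sigma> = {f \<in> cantor_space \<kappa>. \<sigma> \<subseteq>\<^sub>m f}"

definition NWD :: "'a rel \<Rightarrow> ('a \<rightharpoonup> bool) set set" where
  "NWD \<kappa> = {A. A \<subseteq> cantor_space \<kappa> \<and>
     (\<forall>\<sigma>\<in>short_binseqs \<kappa>. \<exists>\<tau>\<in>short_binseqs \<kappa>. \<sigma> \<subseteq>\<^sub>m \<tau> \<and> basic_clopen \<kappa> \<tau> \<inter> A = {})}"

definition meager :: "'a rel \<Rightarrow> ('a \<rightharpoonup> bool) set set" where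
  "meager \<kappa> = {A. \<exists>F. F \<subseteq> NWD \<kappa> \<and> |F| \<le>o \<kappa> \<and> A = \<Union>F}"

text \<open>The set $\kappa^\lambda$ of functions from $\lambda$ to $\kappa$ (not cardinal exponentiation).\<close>

definition fun_space :: "'a rel \<Rightarrow> 'b rel \<Rightarrow> ('b \<Rightarrow> 'a) set" where
  "fun_space \<kappa> lam = (Field lam \<rightarrow>\<^sub>E Field \<kappa>)"

text \<open>\<open>f \<le>\<^sup>* g\<close>: the exceptional set has size below \<open>\<kappa>\<close> (not below the size of the index set).\<close>

definition le_star :: "'a rel \<Rightarrow> 'b rel \<Rightarrow> ('b \<Rightarrow> 'a) \<Rightarrow> ('b \<Rightarrow> 'a) \<Rightarrow> bool" where
  "le_star \<kappa> lam f g \<longleftrightarrow> |{\<gamma> \<in> Field lam. g \<gamma> \<in> underS \<kappa> (f \<gamma>)}| <o \<kappa>"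

definition subsets_of_card :: "'c set \<Rightarrow> 'b rel \<Rightarrow> 'c set set" where
  "subsets_of_card X \<mu> = {Y. Y \<subseteq> X \<and> |Y| =o \<mu>}"

end

theory Submission imports Defs begin

text \<open>
  Above every short sequence \<open>\<sigma>\<close> there is an antichain \<open>c \<sigma> \<gamma>\<close> of short sequences indexed by
  \<open>\<gamma> < lam\<close>. Given \<open>g\<close>, let the branches of \<open>\<Phi>_minus g\<close> be made of consecutive blocks: from a
  node \<open>\<sigma>\<close>, a block first picks some \<open>\<gamma>\<close> by passing through \<open>c \<sigma> \<gamma>\<close>, is free up to position
  \<open>g \<gamma>\<close>, and has the forced bit \<open>False\<close> there. Violating the next forced bit leaves this set, so it
  is nowhere dense.

  If \<open>A\<close> is the union of nowhere dense \<open>B i\<close>, \<open>i < \<kappa>\<close>, let \<open>\<Phi>_plus A\<close> contain, for every \<open>\<sigma>\<close> and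
  \<open>i\<close>, the function that maps \<open>\<gamma>\<close> to the length of an extension of \<open>c \<sigma> \<gamma>\<close> whose cone avoids
  \<open>B i\<close>. If \<open>g\<close> exceeds this function at a single \<open>\<gamma>\<close>, then some block of \<open>g\<close> from \<open>\<sigma>\<close>
  avoids \<open>B i\<close>; so if \<open>g\<close> is not bounded by \<open>\<Phi>_plus A\<close>, a recursion of length \<open>\<kappa>\<close> builds
  a branch of \<open>\<Phi>_minus g\<close> outside \<open>A\<close>.
\<close>

section \<open>Partial maps ordered by extension, and unions of families of them\<close>

lemma map_le_common:
  assumes "s \<subseteq>\<^sub>m x" "t \<subseteq>\<^sub>m x" "dom s \<subseteq> dom t"
  shows "s \<subseteq>\<^sub>m t"
  using assms unfolding map_le_def by (simp add: subset_iff)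

lemma map_le_common_eq:
  assumes "s \<subseteq>\<^sub>m x" "t \<subseteq>\<^sub>m x" "dom s = dom t"
  shows "s = t"
  by (rule map_le_antisym) (rule map_le_common[of _ x]; simp add: assms)+

text \<open>For pairwise compatible maps the choice of \<open>m\<close> does not affect the value.
  The definition is total, so that compatibility can be proved separately.\<close>

definition map_Union :: "('a \<rightharpoonup> 'b) set \<Rightarrow> 'a \<rightharpoonup> 'b" where
  "map_Union M p = (if \<exists>m\<in>M. p \<in> dom m then (SOME m. m \<in> M \<and> p \<in> dom m) p else None)"

lemma map_UnionE:
  assumes "p \<in> dom m" "m \<in> M"
  obtains m' where "m' \<in> M" "p \<in> dom m'" "map_Union M p = m' p"
proof -
  have "\<exists>m. m \<in> M \<and> p \<in> dom m" using assms by blast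
  from someI_ex[OF this] assms show thesis
    by (intro that[of "SOME m. m \<in> M \<and> p \<in> dom m"]) (auto simp: map_Union_def)
qed

lemma dom_map_Union: "dom (map_Union M) = (\<Union>m\<in>M. dom m)"
proof
  show "dom (map_Union M) \<subseteq> (\<Union>m\<in>M. dom m)"
    by (auto simp: map_Union_def split: if_splits)
  show "(\<Union>m\<in>M. dom m) \<subseteq> dom (map_Union M)"
  proof
    fix p assume "p \<in> (\<Union>m\<in>M. dom m)"
    then obtain m where "p \<in> dom m" "m \<in> M" by blast
    then show "p \<in> dom (map_Union M)" by (rule map_UnionE) (simp add: domIff)
  qed
qed

lemma map_le_map_Union:
  assumes "m \<in> M" and "\<And>m'. m' \<in> M \<Longrightarrow> m \<subseteq>\<^sub>m m' \<or> m' \<subseteq>\<^sub>m m"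
  shows "m \<subseteq>\<^sub>m map_Union M"
  unfolding map_le_def
proof
  fix p assume p: "p \<in> dom m"
  then obtain m' where "m' \<in> M" "p \<in> dom m'" "map_Union M p = m' p"
    using assms(1) by (rule map_UnionE)
  with assms(2)[of m'] p show "m p = map_Union M p" by (auto simp: map_le_def dest!: bspec[of _ _ p])
qed

lemma map_Union_map_le:
  assumes "\<And>m. m \<in> M \<Longrightarrow> m \<subseteq>\<^sub>m x"
  shows "map_Union M \<subseteq>\<^sub>m x"
  unfolding map_le_def dom_map_Union
proof
  fix p assume "p \<in> (\<Union>m\<in>M. dom m)"
  then obtain m where "p \<in> dom m" "m \<in> M" by blast
  then show "map_Union M p = x p"
    by (rule map_UnionE) (use assms in \<open>auto simp: map_le_def\<close>)
qed

lemma ex_map_extension: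
  assumes "dom s \<subseteq> D"
  shows "\<exists>t. dom t = D \<and> s \<subseteq>\<^sub>m t \<and> (\<forall>p\<in>D - dom s. t p = Some b)"
  using assms
  by (intro exI[of _ "\<lambda>p. if p \<in> dom s then s p else if p \<in> D then Some b else None"])
    (auto simp: map_le_def dom_def split: if_splits)

section \<open>Initial segments and short sequences for a regular cardinal\<close>

locale infinite_regular = wo_rel \<kappa> for \<kappa> :: "'a rel" +
  assumes Card: "Card_order \<kappa>" and regular: "regularCard \<kappa>" and infinite_Field: "infinite (Field \<kappa>)"
begin

abbreviation Short :: "('a \<rightharpoonup> bool) set" where "Short \<equiv> short_binseqs \<kappa>"

lemma under_neq_Field: "under a \<noteq> Field \<kappa>"
  using Card_order_infinite_not_under[OF Card infinite_Field] by blast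

lemma underS_sub: "underS a \<subseteq> Field \<kappa>"
  by (auto intro: underS_Field)

text \<open>An infinite cardinal has no largest element, so for \<open>a\<close> in the field the
  witness \<open>b\<close> is the successor of \<open>a\<close>.\<close>

lemma under_eq_underS: "\<exists>b\<in>Field \<kappa>. under a = underS b"
  using ofilter_underS_Field[of "under a"] under_ofilter under_neq_Field by blast

text \<open>The proper order filters of a well-order are its open initial segments. In this form
  shortness of a union can be checked without naming its length.\<close>

lemma Short_iff: "\<sigma> \<in> Short \<longleftrightarrow> ofilter (dom \<sigma>) \<and> dom \<sigma> \<noteq> Field \<kappa>"
proof -
  have "underS a \<noteq> Field \<kappa>" if "a \<in> Field \<kappa>" for a
    using that underS_notIn[of a] by blast
  then show ?thesis
    unfolding ofilter_underS_Field short_binseqs_def binseqs_def by blast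
qed

lemma ShortE:
  assumes "\<sigma> \<in> Short"
  obtains \<alpha> where "\<alpha> \<in> Field \<kappa>" "dom \<sigma> = underS \<alpha>"
  using assms by (auto simp: short_binseqs_def binseqs_def)

lemma Short_underS: "\<alpha> \<in> Field \<kappa> \<Longrightarrow> dom \<sigma> = underS \<alpha> \<Longrightarrow> \<sigma> \<in> Short"
  by (auto simp: short_binseqs_def binseqs_def)

lemma Short_under: "dom \<sigma> = under \<alpha> \<Longrightarrow> \<sigma> \<in> Short"
  using under_eq_underS[of \<alpha>] Short_underS by auto

lemma underS_total: "a \<in> Field \<kappa> \<Longrightarrow> b \<in> Field \<kappa> \<Longrightarrow> a \<in> underS b \<or> a = b \<or> b \<in> underS a"
  using TOTALS by (auto simp: underS_def)

lemma underS_asym: "a \<in> underS b \<Longrightarrow> b \<notin> underS a"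
  using ANTISYM by (auto simp: underS_def antisym_def)

lemma mem_under: "a \<in> Field \<kappa> \<Longrightarrow> b \<in> under a \<longleftrightarrow> b = a \<or> b \<in> underS a"
  using REFL by (auto simp: under_def underS_def refl_on_def)

lemma ofilter_subset_underS:
  assumes "ofilter A" "p \<in> Field \<kappa>" "p \<notin> A"
  shows "A \<subseteq> underS p"
proof
  fix q assume q: "q \<in> A"
  then have "q \<in> Field \<kappa>" "under q \<subseteq> A" using assms(1) by (auto simp: ofilter_def)
  then show "q \<in> underS p"
    using underS_total[of q p] assms(2,3) q underS_subset_under[of \<kappa> q] by auto
qed

text \<open>By regularity a set of smaller size is not cofinal, so some \<open>a\<close> has no
  element of \<open>A\<close> strictly above it; the successor of \<open>a\<close> is then a strict
  bound.\<close>

lemma bounded_by_regularity: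
  assumes "A \<subseteq> Field \<kappa>" "|A| <o \<kappa>"
  shows "\<exists>\<alpha>\<in>Field \<kappa>. A \<subseteq> underS \<alpha>"
proof -
  have "\<not> cofinal A \<kappa>"
    using assms regular not_ordLess_ordIso unfolding regularCard_def by blast
  then obtain a where a: "a \<in> Field \<kappa>" "\<And>b. b \<in> A \<Longrightarrow> a = b \<or> (a, b) \<notin> \<kappa>"
    unfolding cofinal_def by blast
  have "A \<subseteq> under a"
  proof
    fix b assume b: "b \<in> A"
    with a(2)[OF b] show "b \<in> under a"
      using assms(1) underS_total[of a b] a(1) mem_under[of a b] by (auto simp: underS_def)
  qed
  then show ?thesis using under_eq_underS[of a] by auto
qed

text \<open>The lengths form a set of size below \<kappa>, which regularity bounds. This keeps the
  stages of the recursion in \<open>ex_escape\<close> short.\<close>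

lemma UN_Short:
  assumes "|I| <o \<kappa>" "\<And>i. i \<in> I \<Longrightarrow> f i \<in> Short"
  shows "ofilter (\<Union>i\<in>I. dom (f i))" "(\<Union>i\<in>I. dom (f i)) \<noteq> Field \<kappa>"
proof -
  show "ofilter (\<Union>i\<in>I. dom (f i))"
    using assms(2) by (intro ofilter_UNION) (simp add: Short_iff)
  have "\<forall>i\<in>I. \<exists>\<alpha>\<in>Field \<kappa>. dom (f i) = underS \<alpha>"
    using assms(2) by (auto simp: short_binseqs_def binseqs_def)
  then obtain l where l: "\<And>i. i \<in> I \<Longrightarrow> l i \<in> Field \<kappa> \<and> dom (f i) = underS (l i)"
    by (auto simp: Bex_def dest!: bchoice)
  have "|l ` I| <o \<kappa>" using assms(1) card_of_image ordLeq_ordLess_trans by blast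
  then obtain \<alpha> where \<alpha>: "\<alpha> \<in> Field \<kappa>" "l ` I \<subseteq> underS \<alpha>"
    using bounded_by_regularity[of "l ` I"] l by blast
  have "\<alpha> \<notin> underS (l i)" if "i \<in> I" for i
    using \<alpha>(2) that underS_asym[of "l i" \<alpha>] by auto
  then have "\<alpha> \<notin> (\<Union>i\<in>I. dom (f i))" using l by auto
  then show "(\<Union>i\<in>I. dom (f i)) \<noteq> Field \<kappa>" using \<alpha>(1) by metis
qed

section \<open>Large antichains above a short sequence\<close>

lemma ex_inj_above:
  assumes "\<beta> \<in> Field \<kappa>"
  shows "\<exists>j :: 'a \<times> bool \<Rightarrow> 'a. inj_on j (Field \<kappa> \<times> UNIV) \<and> j ` (Field \<kappa> \<times> UNIV) \<subseteq> Field \<kappa> - underS \<beta>"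
proof -
  have F: "|Field \<kappa>| =o \<kappa>" using Card card_of_Field_ordIso by blast
  have "|UNIV :: bool set| \<le>o |Field \<kappa>|"
    using card_of_ordLeq_finite[OF _ finite_UNIV] infinite_Field
      ordLeq_total[OF card_of_Well_order card_of_Well_order] by blast
  then have bF: "|UNIV :: bool set| \<le>o \<kappa>" using F by (rule ordLeq_ordIso_trans)
  have "|Field \<kappa> \<times> (UNIV :: bool set)| \<le>o \<kappa>"
    using card_of_Times_ordLeq_infinite_Field[OF infinite_Field _ bF Card]
      F ordIso_iff_ordLeq by blast
  \<comment> \<open>Removing a segment of size below \<kappa> leaves \<kappa> positions, enough for
    two code positions per element of the field.\<close>
  moreover have "\<kappa> \<le>o |Field \<kappa> - underS \<beta>|"
  proof (rule ccontr)
    assume "\<not> \<kappa> \<le>o |Field \<kappa> - underS \<beta>|"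
    then have "|Field \<kappa> - underS \<beta>| <o \<kappa>"
      using WELL card_of_Well_order not_ordLeq_iff_ordLess by blast
    then have "|underS \<beta> \<union> (Field \<kappa> - underS \<beta>)| <o \<kappa>"
      using card_of_Un_ordLess_infinite_Field[OF infinite_Field Card] card_of_underS[OF Card assms] by blast
    moreover have "underS \<beta> \<union> (Field \<kappa> - underS \<beta>) = Field \<kappa>"
      using underS_sub[of \<beta>] by blast
    ultimately show False using F not_ordLess_ordIso by auto
  qed
  ultimately have "|Field \<kappa> \<times> (UNIV :: bool set)| \<le>o |Field \<kappa> - underS \<beta>|"
    by (rule ordLeq_transitive)
  then show ?thesis unfolding card_of_ordLeq[symmetric] by blast
qed

text \<open>The antichain is indexed by \<open>Short\<close> itself, which has the right size:
  \<open>c \<tau>\<close> writes a code of \<open>\<tau>\<close> on positions outside the domain of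
  \<open>\<sigma>\<close>, and a common extension \<open>z\<close> of two codes decodes to both
  sequences.\<close>

lemma ex_antichain_above:
  assumes \<sigma>: "\<sigma> \<in> Short"
  shows "\<exists>c. (\<forall>\<tau>\<in>Short. c \<tau> \<in> Short \<and> \<sigma> \<subseteq>\<^sub>m c \<tau>) \<and>
    (\<forall>\<tau>\<in>Short. \<forall>\<tau>'\<in>Short. \<forall>z. c \<tau> \<subseteq>\<^sub>m z \<longrightarrow> c \<tau>' \<subseteq>\<^sub>m z \<longrightarrow> \<tau> = \<tau>')"
proof -
  obtain \<beta> where \<beta>: "\<beta> \<in> Field \<kappa>" "dom \<sigma> = underS \<beta>" using \<sigma> by (rule ShortE)
  obtain j :: "'a \<times> bool \<Rightarrow> 'a" where j: "inj_on j (Field \<kappa> \<times> UNIV)"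
    and j_above: "j ` (Field \<kappa> \<times> UNIV) \<subseteq> Field \<kappa> - underS \<beta>"
    using ex_inj_above[OF \<beta>(1)] by blast
  \<comment> \<open>The positions \<open>j (p, True)\<close> record which \<open>p\<close> lie in the domain of \<open>\<tau>\<close>; since \<open>c \<tau>\<close> also
    covers the one belonging to the length of \<open>\<tau>\<close>, codes of sequences of different lengths clash.\<close>
  define R where "R \<tau> = (\<lambda>c. c \<in> Short \<and> \<sigma> \<subseteq>\<^sub>m c \<and>
    (\<forall>\<alpha>\<in>Field \<kappa>. dom \<tau> = underS \<alpha> \<longrightarrow> (\<forall>p\<in>under \<alpha>.
       c (j (p, True)) = Some (p \<in> dom \<tau>) \<and> c (j (p, False)) = Some (\<tau> p = Some True))))"
    for \<tau> :: "'a \<rightharpoonup> bool"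
  have "\<exists>c. R \<tau> c" if "\<tau> \<in> Short" for \<tau>
  proof -
    obtain \<alpha> where \<alpha>: "\<alpha> \<in> Field \<kappa>" "dom \<tau> = underS \<alpha>" using \<open>\<tau> \<in> Short\<close> by (rule ShortE)
    have U: "under \<alpha> \<subseteq> Field \<kappa>" by (rule under_Field)
    obtain \<alpha>' where \<alpha>': "\<alpha>' \<in> Field \<kappa>" "under \<alpha> = underS \<alpha>'" using under_eq_underS by blast
    have u: "|under \<alpha>| <o \<kappa>" using card_of_underS[OF Card] \<alpha>' by simp
    have "|(\<lambda>p. j (p, True)) ` under \<alpha> \<union> (\<lambda>p. j (p, False)) ` under \<alpha>| <o \<kappa>"
      using u by (intro card_of_Un_ordLess_infinite_Field infinite_Field Card
          ordLeq_ordLess_trans[OF card_of_image])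
    moreover have "(\<lambda>p. j (p, True)) ` under \<alpha> \<union> (\<lambda>p. j (p, False)) ` under \<alpha> \<subseteq> Field \<kappa>"
      using U j_above by blast
    \<comment> \<open>Fewer than \<kappa> positions are used for the code of \<open>\<tau>\<close>;
      a common bound of them serves as the length of \<open>c \<tau>\<close>.\<close>
    ultimately obtain \<epsilon> where \<epsilon>: "\<epsilon> \<in> Field \<kappa>" and
      j\<epsilon>: "\<And>p b. p \<in> under \<alpha> \<Longrightarrow> j (p, b) \<in> underS \<epsilon>"
      using bounded_by_regularity[of "(\<lambda>p. j (p, True)) ` under \<alpha> \<union> (\<lambda>p. j (p, False)) ` under \<alpha>"]
      by (smt (verit) Un_iff image_eqI subsetD)
    have j_notin: "j (p, b) \<notin> dom \<sigma>" if "p \<in> under \<alpha>" for p b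
      using that U j_above \<beta>(2) by blast
    have "\<alpha> \<in> under \<alpha>" using \<alpha>(1) REFL by (auto simp: under_def refl_on_def)
    \<comment> \<open>The code position \<open>j (\<alpha>, True)\<close> is outside the order
      filter \<open>dom \<sigma>\<close>, so all of \<open>dom \<sigma>\<close> lies below it, hence
      below \<open>\<epsilon>\<close>.\<close>
    then have sub: "dom \<sigma> \<subseteq> underS \<epsilon>"
      using underS_ofilter[of \<epsilon>] ofilter_subset_underS[of "dom \<sigma>" "j (\<alpha>, True)"] j\<epsilon>[of \<alpha> True]
        j_notin[of \<alpha> True] \<sigma> underS_sub[of \<epsilon>] underS_subset_under[of \<kappa> "j (\<alpha>, True)"]
      unfolding Short_iff ofilter_def by blast
    \<comment> \<open>\<open>B\<close> collects the code positions with bit \<open>True\<close>.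
      Fillers get \<open>False\<close>, and so does \<open>j (\<alpha>, True)\<close>, the end
      marker.\<close>
    define B where "B = (\<lambda>p. j (p, True)) ` dom \<tau> \<union> (\<lambda>p. j (p, False)) ` {p. \<tau> p = Some True}"
    define c where "c = (\<lambda>q. if q \<in> dom \<sigma> then \<sigma> q else if q \<in> underS \<epsilon> then Some (q \<in> B) else None)"
    have "dom c = underS \<epsilon>" using sub by (auto simp: c_def dom_def split: if_splits)
    then have "c \<in> Short" using \<epsilon> by (rule Short_underS[rotated])
    moreover have "\<sigma> \<subseteq>\<^sub>m c" by (auto simp: c_def map_le_def)
    moreover have "c (j (p, True)) = Some (p \<in> dom \<tau>)" "c (j (p, False)) = Some (\<tau> p = Some True)"
      if p: "p \<in> under \<alpha>" for p
    proof -
      have D: "dom \<tau> \<subseteq> Field \<kappa>" using \<alpha>(2) underS_sub by simp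
      have eq: "j (p, b) = j (q, b') \<longleftrightarrow> p = q \<and> b = b'" if "q \<in> dom \<tau>" for q b b'
        using inj_on_eq_iff[OF j, of "(p, b)" "(q, b')"] p U D that by auto
      have "j (p, b) \<in> B \<longleftrightarrow> (\<exists>q\<in>dom \<tau>. j (p, b) = j (q, True) \<or> j (p, b) = j (q, False) \<and> \<tau> q = Some True)" for b
        unfolding B_def by blast
      then have "j (p, b) \<in> B \<longleftrightarrow> (\<exists>q\<in>dom \<tau>. p = q \<and> (b \<or> \<tau> q = Some True))" for b
        using eq by (cases b) (simp_all cong: bex_cong)
      then have "j (p, True) \<in> B \<longleftrightarrow> p \<in> dom \<tau>" "j (p, False) \<in> B \<longleftrightarrow> \<tau> p = Some True"
        by auto
      then show "c (j (p, True)) = Some (p \<in> dom \<tau>)" "c (j (p, False)) = Some (\<tau> p = Some True)"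
        using j_notin[OF p] j\<epsilon>[OF p] by (auto simp: c_def)
    qed
    moreover have "\<alpha>'' = \<alpha>" if "\<alpha>'' \<in> Field \<kappa>" "dom \<tau> = underS \<alpha>''" for \<alpha>''
      using that \<alpha> underS_total[of \<alpha>'' \<alpha>] underS_notIn by fast
    ultimately have "R \<tau> c" unfolding R_def by blast
    then show ?thesis by blast
  qed
  then obtain c where c: "\<And>\<tau>. \<tau> \<in> Short \<Longrightarrow> R \<tau> (c \<tau>)" by metis
  have "\<tau> = \<tau>'" if \<tau>: "\<tau> \<in> Short" "\<tau>' \<in> Short" and z: "c \<tau> \<subseteq>\<^sub>m z" "c \<tau>' \<subseteq>\<^sub>m z" for \<tau> \<tau>' z
  proof -
    obtain \<alpha> where \<alpha>: "\<alpha> \<in> Field \<kappa>" "dom \<tau> = underS \<alpha>" using \<tau>(1) by (rule ShortE)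
    obtain \<alpha>' where \<alpha>': "\<alpha>' \<in> Field \<kappa>" "dom \<tau>' = underS \<alpha>'" using \<tau>(2) by (rule ShortE)
    have refl: "\<alpha> \<in> under \<alpha>" "\<alpha>' \<in> under \<alpha>'"
      using \<alpha>(1) \<alpha>'(1) REFL by (auto simp: under_def refl_on_def)
    have zv: "z (j (p, True)) = Some (p \<in> dom \<tau>)" "z (j (p, False)) = Some (\<tau> p = Some True)"
      if "p \<in> under \<alpha>" for p
      using c[OF \<tau>(1)] \<alpha> that z(1) unfolding R_def map_le_def by (metis domI)+
    have zv': "z (j (p, True)) = Some (p \<in> dom \<tau>')" "z (j (p, False)) = Some (\<tau>' p = Some True)"
      if "p \<in> under \<alpha>'" for p
      using c[OF \<tau>(2)] \<alpha>' that z(2) unfolding R_def map_le_def by (metis domI)+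
    have "\<alpha> = \<alpha>'"
    proof (rule cases_Total3[of \<alpha> \<alpha>'])
      show "{\<alpha>, \<alpha>'} \<subseteq> Field \<kappa>" using \<alpha> \<alpha>' by simp
      \<comment> \<open>The smaller of the two lengths is in the domain of the longer sequence only,
        so the codes demand different bits at its position.\<close>
      assume "(\<alpha>, \<alpha>') \<in> \<kappa> - Id \<or> (\<alpha>', \<alpha>) \<in> \<kappa> - Id"
      then have "\<alpha> \<in> underS \<alpha>' \<or> \<alpha>' \<in> underS \<alpha>" by (auto simp: underS_def)
      then show "\<alpha> = \<alpha>'"
        using zv(1) zv'(1) refl \<alpha>(2) \<alpha>'(2) underS_subset_under underS_notIn
        by (metis option.inject subsetD)
    qed
    then have d: "dom \<tau> = dom \<tau>'" using \<alpha>(2) \<alpha>'(2) by simp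
    show ?thesis
    proof (rule map_le_antisym; unfold map_le_def; intro ballI)
      have *: "\<tau> p = \<tau>' p" if p: "p \<in> dom \<tau>" for p
      proof -
        have "p \<in> under \<alpha>" using that \<alpha>(2) underS_subset_under by fast
        then have "\<tau> p = Some True \<longleftrightarrow> \<tau>' p = Some True" using zv(2) zv'(2) \<open>\<alpha> = \<alpha>'\<close> by simp
        moreover obtain a b where "\<tau> p = Some a" "\<tau>' p = Some b" using p d by blast
        ultimately show ?thesis by auto
      qed
      show "\<And>p. p \<in> dom \<tau> \<Longrightarrow> \<tau> p = \<tau>' p" "\<And>p. p \<in> dom \<tau>' \<Longrightarrow> \<tau>' p = \<tau> p" using * d by auto
    qed
  qed
  then show ?thesis using c unfolding R_def by (intro exI[of _ c]) blast
qed

end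

section \<open>Branches made of blocks\<close>

locale coding = infinite_regular +
  fixes I :: "'i set" and c :: "('a \<rightharpoonup> bool) \<Rightarrow> 'i \<Rightarrow> ('a \<rightharpoonup> bool)"
  assumes c_Short: "\<sigma> \<in> Short \<Longrightarrow> \<gamma> \<in> I \<Longrightarrow> c \<sigma> \<gamma> \<in> Short"
    and c_ext: "\<sigma> \<in> Short \<Longrightarrow> \<gamma> \<in> I \<Longrightarrow> \<sigma> \<subseteq>\<^sub>m c \<sigma> \<gamma>"
    and c_antichain: "\<sigma> \<in> Short \<Longrightarrow> \<gamma> \<in> I \<Longrightarrow> \<gamma>' \<in> I \<Longrightarrow> c \<sigma> \<gamma> \<subseteq>\<^sub>m z \<Longrightarrow> c \<sigma> \<gamma>' \<subseteq>\<^sub>m z \<Longrightarrow> \<gamma> = \<gamma>'"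
begin

text \<open>The forced bit is the last one of the block. A \<open>\<gamma>\<close> whose code
  already covers position \<open>g \<gamma>\<close> offers no block.\<close>

definition block :: "('i \<Rightarrow> 'a) \<Rightarrow> ('a \<rightharpoonup> bool) \<Rightarrow> 'i \<Rightarrow> ('a \<rightharpoonup> bool) \<Rightarrow> bool" where
  "block g \<sigma> \<gamma> \<tau> \<longleftrightarrow> \<gamma> \<in> I \<and> c \<sigma> \<gamma> \<subseteq>\<^sub>m \<tau> \<and> dom \<tau> = under (g \<gamma>) \<and>
     g \<gamma> \<notin> dom (c \<sigma> \<gamma>) \<and> \<tau> (g \<gamma>) = Some False"

text \<open>Nodes are the places where a block may begin. The empty sequence is a node by
  \<open>limit\<close>, whose second premise is then vacuous.\<close>

inductive node :: "('i \<Rightarrow> 'a) \<Rightarrow> ('a \<rightharpoonup> bool) \<Rightarrow> bool" for g where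
  limit: "\<sigma> \<in> Short \<Longrightarrow> (\<And>p. p \<in> dom \<sigma> \<Longrightarrow> \<exists>\<rho>. node g \<rho> \<and> \<rho> \<subseteq>\<^sub>m \<sigma> \<and> p \<in> dom \<rho>) \<Longrightarrow> node g \<sigma>"
| step: "node g \<sigma> \<Longrightarrow> block g \<sigma> \<gamma> \<tau> \<Longrightarrow> node g \<tau>"

text \<open>Short unions of nodes on \<open>x\<close> are nodes and every node on \<open>x\<close>
  is continued, so the nodes exhaust \<open>x\<close>; no decomposition has to be carried along as
  data.\<close>

definition Blocks :: "('i \<Rightarrow> 'a) \<Rightarrow> ('a \<rightharpoonup> bool) set" where
  "Blocks g = {x \<in> cantor_space \<kappa>. \<forall>\<sigma>. node g \<sigma> \<longrightarrow> \<sigma> \<subseteq>\<^sub>m x \<longrightarrow> (\<exists>\<gamma> \<tau>. block g \<sigma> \<gamma> \<tau> \<and> \<tau> \<subseteq>\<^sub>m x)}"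

lemma block_Short: "block g \<sigma> \<gamma> \<tau> \<Longrightarrow> \<tau> \<in> Short"
  unfolding block_def using Short_under by blast

lemma node_Short: "node g \<sigma> \<Longrightarrow> \<sigma> \<in> Short"
  by (induction rule: node.induct) (auto intro: block_Short)

lemma block_ext: "\<sigma> \<in> Short \<Longrightarrow> block g \<sigma> \<gamma> \<tau> \<Longrightarrow> \<sigma> \<subseteq>\<^sub>m \<tau> \<and> g \<gamma> \<in> dom \<tau> - dom \<sigma>"
  using map_le_trans[OF c_ext] map_le_implies_dom_le[OF c_ext, of \<sigma> \<gamma>] by (auto simp: block_def)

text \<open>The antichain determines \<open>\<gamma>\<close> from \<open>z\<close>, and
  \<open>g \<gamma>\<close> then determines the domain.\<close>

lemma block_unique:
  assumes "\<sigma> \<in> Short" "block g \<sigma> \<gamma> \<tau>" "block g \<sigma> \<gamma>' \<tau>'" "\<tau> \<subseteq>\<^sub>m z" "\<tau>' \<subseteq>\<^sub>m z"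
  shows "\<tau> = \<tau>'"
proof -
  have "\<gamma> = \<gamma>'"
    using assms c_antichain[of \<sigma> \<gamma> \<gamma>' z] map_le_trans[of _ _ z] unfolding block_def by blast
  then show ?thesis using assms map_le_common_eq[of \<tau> z \<tau>'] unfolding block_def by simp
qed

text \<open>The union of all nodes below \<open>\<sigma>\<close> is again a node, by
  \<open>limit\<close>.\<close>

lemma ex_last_node:
  assumes "\<sigma> \<in> Short"
  shows "\<exists>\<mu>. node g \<mu> \<and> \<mu> \<subseteq>\<^sub>m \<sigma> \<and> (\<forall>\<rho>. node g \<rho> \<longrightarrow> \<rho> \<subseteq>\<^sub>m \<sigma> \<longrightarrow> \<rho> \<subseteq>\<^sub>m \<mu>)"
proof -
  define M where "M = {\<rho>. node g \<rho> \<and> \<rho> \<subseteq>\<^sub>m \<sigma>}"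
  have le: "map_Union M \<subseteq>\<^sub>m \<sigma>" by (rule map_Union_map_le) (simp add: M_def)
  have sub: "\<rho> \<subseteq>\<^sub>m map_Union M" if "\<rho> \<in> M" for \<rho>
    by (rule map_le_common[of _ \<sigma>]) (use that le in \<open>auto simp: M_def dom_map_Union\<close>)
  have "ofilter (dom (map_Union M))"
    unfolding dom_map_Union by (rule ofilter_UNION) (auto simp: M_def Short_iff dest: node_Short)
  moreover have "dom (map_Union M) \<noteq> Field \<kappa>"
    using map_le_implies_dom_le[OF le] assms by (auto simp: Short_iff ofilter_def)
  ultimately have "map_Union M \<in> Short" by (simp add: Short_iff)
  then have "node g (map_Union M)"
  proof (rule limit)
    fix p assume "p \<in> dom (map_Union M)"
    then obtain \<rho> where "\<rho> \<in> M" "p \<in> dom \<rho>" unfolding dom_map_Union by blast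
    then show "\<exists>\<rho>. node g \<rho> \<and> \<rho> \<subseteq>\<^sub>m map_Union M \<and> p \<in> dom \<rho>"
      using sub by (auto simp: M_def)
  qed
  then show ?thesis using le sub by (intro exI[of _ "map_Union M"]) (simp add: M_def)
qed

text \<open>If the cone of \<open>\<sigma>\<close> meets the set, a branch there continues the last
  node \<open>\<mu>\<close> below \<open>\<sigma>\<close> by a block \<open>\<tau>\<close>. Its
  forced position is not yet decided by \<open>\<sigma>\<close>, as otherwise \<open>\<tau>\<close>
  would be a later node below \<open>\<sigma>\<close>.\<close>

lemma Blocks_NWD: "Blocks g \<in> NWD \<kappa>"
  unfolding NWD_def
proof (intro CollectI conjI ballI)
  show "Blocks g \<subseteq> cantor_space \<kappa>" by (auto simp: Blocks_def)
  fix \<sigma> assume \<sigma>: "\<sigma> \<in> Short"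
  obtain \<mu> where \<mu>: "node g \<mu>" "\<mu> \<subseteq>\<^sub>m \<sigma>" and last: "\<And>\<rho>. node g \<rho> \<Longrightarrow> \<rho> \<subseteq>\<^sub>m \<sigma> \<Longrightarrow> \<rho> \<subseteq>\<^sub>m \<mu>"
    using ex_last_node[OF \<sigma>] by blast
  note \<mu>S = node_Short[OF \<mu>(1)]
  show "\<exists>\<tau>\<in>Short. \<sigma> \<subseteq>\<^sub>m \<tau> \<and> basic_clopen \<kappa> \<tau> \<inter> Blocks g = {}"
  proof (cases "basic_clopen \<kappa> \<sigma> \<inter> Blocks g = {}")
    case True
    then show ?thesis using \<sigma> map_le_refl by blast
  next
    case False
    then obtain y where y: "\<sigma> \<subseteq>\<^sub>m y" "y \<in> Blocks g" by (auto simp: basic_clopen_def)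
    then obtain \<gamma> \<tau> where b: "block g \<mu> \<gamma> \<tau>" and \<tau>y: "\<tau> \<subseteq>\<^sub>m y"
      using \<mu> map_le_trans[OF \<mu>(2) y(1)] unfolding Blocks_def by blast
    have g\<gamma>: "g \<gamma> \<in> dom \<tau>" "g \<gamma> \<notin> dom \<mu>" using block_ext[OF \<mu>S b] by auto
    have notin: "g \<gamma> \<notin> dom \<sigma>"
    proof
      assume "g \<gamma> \<in> dom \<sigma>"
      then have "dom \<tau> \<subseteq> dom \<sigma>" using b \<sigma> by (auto simp: block_def Short_iff ofilter_def)
      with \<tau>y y(1) have "\<tau> \<subseteq>\<^sub>m \<sigma>" by (rule map_le_common)
      then have "\<tau> \<subseteq>\<^sub>m \<mu>" using last step[OF \<mu>(1) b] by blast
      then show False using g\<gamma> map_le_implies_dom_le[of \<tau> \<mu>] by blast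
    qed
    have "dom \<tau> \<subseteq> Field \<kappa>"
      using block_Short[OF b] by (simp add: Short_iff ofilter_def)
    then have "dom \<sigma> \<subseteq> underS (g \<gamma>)"
      using \<sigma> g\<gamma>(1) notin by (intro ofilter_subset_underS) (auto simp: Short_iff)
    then have "dom \<sigma> \<subseteq> dom \<tau>" using b underS_subset_under[of \<kappa> "g \<gamma>"] by (auto simp: block_def)
    with y(1) \<tau>y have "\<sigma> \<subseteq>\<^sub>m \<tau>" by (rule map_le_common)
    \<comment> \<open>Flipping the forced bit leaves the code \<open>c \<mu> \<gamma>\<close>
      intact, so a branch through \<open>\<tau>'\<close> must still choose \<open>\<gamma>\<close>
      after \<open>\<mu>\<close> and has the wrong bit at \<open>g \<gamma>\<close>.\<close>
    define \<tau>' where "\<tau>' = \<tau>(g \<gamma> \<mapsto> True)"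
    have "dom \<tau>' = dom \<tau>" using g\<gamma>(1) by (auto simp: \<tau>'_def)
    then have "\<tau>' \<in> Short" using block_Short[OF b] by (simp add: Short_iff)
    moreover have "\<sigma> \<subseteq>\<^sub>m \<tau>'"
      using \<open>\<sigma> \<subseteq>\<^sub>m \<tau>\<close> notin by (auto simp: \<tau>'_def map_le_def)
    moreover have "z \<notin> Blocks g" if z: "\<tau>' \<subseteq>\<^sub>m z" for z
    proof
      assume "z \<in> Blocks g"
      moreover have "\<mu> \<subseteq>\<^sub>m z" using map_le_trans[OF map_le_trans[OF \<mu>(2) \<open>\<sigma> \<subseteq>\<^sub>m \<tau>'\<close>] z] .
      ultimately obtain \<gamma>' \<tau>'' where b': "block g \<mu> \<gamma>' \<tau>''" "\<tau>'' \<subseteq>\<^sub>m z"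
        using \<mu>(1) unfolding Blocks_def by blast
      have "c \<mu> \<gamma> \<subseteq>\<^sub>m \<tau>'" using b by (auto simp: block_def \<tau>'_def map_le_def)
      then have "\<gamma> = \<gamma>'"
        using c_antichain[OF \<mu>S, of \<gamma> \<gamma>' z] b b' map_le_trans[OF _ z] map_le_trans[OF _ b'(2)]
        unfolding block_def by blast
      then have "z (g \<gamma>) = Some False"
        using b' by (auto simp: block_def map_le_def dest!: bspec[of "under _" _ "g \<gamma>"])
      moreover have "z (g \<gamma>) = Some True" using z by (simp add: \<tau>'_def map_le_def)
      ultimately show False by simp
    qed
    ultimately show ?thesis by (intro bexI[of _ \<tau>']) (auto simp: basic_clopen_def)
  qed
qed

section \<open>Escaping \<kappa> many sets inside \<open>Blocks g\<close>\<close>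

lemma ex_escape_step:
  assumes g: "g \<in> I \<rightarrow> Field \<kappa>"
    and h: "\<And>i \<rho>. i \<in> Field \<kappa> \<Longrightarrow> \<rho> \<in> Short \<Longrightarrow>
      h i \<rho> \<in> Short \<and> \<rho> \<subseteq>\<^sub>m h i \<rho> \<and> basic_clopen \<kappa> (h i \<rho>) \<inter> A i = {}"
    and unbounded: "\<exists>\<gamma>\<in>I. dom (h i (c \<sigma> \<gamma>)) \<subseteq> underS (g \<gamma>)"
    and \<sigma>: "\<sigma> \<in> Short" and i: "i \<in> Field \<kappa>"
  shows "\<exists>\<tau> \<gamma>. block g \<sigma> \<gamma> \<tau> \<and> basic_clopen \<kappa> \<tau> \<inter> A i = {}"
proof -
  obtain \<gamma> where \<gamma>: "\<gamma> \<in> I" "dom (h i (c \<sigma> \<gamma>)) \<subseteq> underS (g \<gamma>)" using unbounded by blast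
  let ?\<rho> = "h i (c \<sigma> \<gamma>)"
  have \<rho>: "c \<sigma> \<gamma> \<subseteq>\<^sub>m ?\<rho>" "basic_clopen \<kappa> ?\<rho> \<inter> A i = {}"
    using h[OF i c_Short[OF \<sigma> \<gamma>(1)]] by auto
  have "dom ?\<rho> \<subseteq> under (g \<gamma>)" using \<gamma>(2) underS_subset_under[of \<kappa> "g \<gamma>"] by blast
  \<comment> \<open>Padding with \<open>False\<close> up to and including position
    \<open>g \<gamma>\<close> supplies the forced bit and stays in the cone that avoids
    \<open>A i\<close>.\<close>
  from ex_map_extension[OF this, of False]
  obtain \<tau> where \<tau>: "dom \<tau> = under (g \<gamma>)" "?\<rho> \<subseteq>\<^sub>m \<tau>" "\<forall>p\<in>under (g \<gamma>) - dom ?\<rho>. \<tau> p = Some False"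
    by blast
  have notin: "g \<gamma> \<notin> dom ?\<rho>" using \<gamma>(2) underS_notIn[of "g \<gamma>"] by blast
  have "g \<gamma> \<in> under (g \<gamma>)" using g \<gamma>(1) REFL by (auto simp: under_def refl_on_def)
  then have "block g \<sigma> \<gamma> \<tau>"
    using \<tau> \<gamma>(1) notin map_le_trans[OF \<rho>(1) \<tau>(2)] map_le_implies_dom_le[OF \<rho>(1)]
    unfolding block_def by auto
  moreover have "basic_clopen \<kappa> \<tau> \<inter> A i = {}"
    using \<rho>(2) map_le_trans[OF \<tau>(2)] unfolding basic_clopen_def by blast
  ultimately show ?thesis by blast
qed

text \<open>A recursion of length \<kappa> appends at stage \<open>i\<close> a block avoiding
  \<open>A i\<close>. Membership of the limit branch in \<open>Blocks g\<close> concerns all nodes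
  on it, so these are shown to be exactly the stages.\<close>

lemma ex_escape:
  assumes step_ex: "\<And>i \<sigma>. i \<in> Field \<kappa> \<Longrightarrow> \<sigma> \<in> Short \<Longrightarrow>
      \<exists>\<tau> \<gamma>. block g \<sigma> \<gamma> \<tau> \<and> basic_clopen \<kappa> \<tau> \<inter> A i = {}"
  shows "\<exists>x\<in>Blocks g. \<forall>i\<in>Field \<kappa>. x \<notin> A i"
proof -
  obtain N where N: "\<And>i \<sigma>. i \<in> Field \<kappa> \<Longrightarrow> \<sigma> \<in> Short \<Longrightarrow>
      (\<exists>\<gamma>. block g \<sigma> \<gamma> (N i \<sigma>)) \<and> basic_clopen \<kappa> (N i \<sigma>) \<inter> A i = {}"
    using step_ex by metis
  \<comment> \<open>\<open>S i\<close> is the node reached before stage \<open>i\<close>, the union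
    of all earlier results; it is empty at the first stage.\<close>
  define S where "S = worec (\<lambda>f i. map_Union ((\<lambda>j. N j (f j)) ` underS i))"
  have "adm_wo (\<lambda>f i. map_Union ((\<lambda>j. N j (f j)) ` underS i))"
    unfolding adm_wo_def by (metis (mono_tags, lifting) image_cong)
  from worec_fixpoint[OF this]
  have S: "S i = map_Union ((\<lambda>j. N j (S j)) ` underS i)" for i
    unfolding S_def by (rule fun_cong)
  define T where "T i = N i (S i)" for i
  have S: "S i = map_Union (T ` underS i)" for i using S[of i] by (simp add: T_def)
  have domS: "dom (S i) = (\<Union>j\<in>underS i. dom (T j))" for i
    by (subst S) (simp add: dom_map_Union)
  have T: "(\<exists>\<gamma>. block g (S i) \<gamma> (T i)) \<and> basic_clopen \<kappa> (T i) \<inter> A i = {}"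
    if "i \<in> Field \<kappa>" "S i \<in> Short" for i using N that unfolding T_def by blast
  \<comment> \<open>The two claims support each other: \<open>T j\<close> extends \<open>S j\<close>
    because \<open>S j\<close> is a node, and \<open>S i\<close> is a node because the earlier
    \<open>T j\<close> form a chain.\<close>
  have inv: "i \<in> Field \<kappa> \<longrightarrow> node g (S i) \<and> (\<forall>j\<in>underS i. T j \<subseteq>\<^sub>m S i)" for i
  proof (induction i rule: well_order_induct)
    case (1 i)
    show ?case
    proof
      assume i: "i \<in> Field \<kappa>"
      have IH: "node g (S j)" "\<And>k. k \<in> underS j \<Longrightarrow> T k \<subseteq>\<^sub>m S j" if "j \<in> underS i" for j
        using 1 that underS_sub[of i] by (auto simp: underS_def)
      have TS: "node g (T j)" "S j \<subseteq>\<^sub>m T j" if j: "j \<in> underS i" for j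
      proof -
        have n: "node g (S j)" using IH(1)[OF j] .
        then obtain \<gamma> where b: "block g (S j) \<gamma> (T j)"
          using T[of j] j underS_sub[of i] node_Short by blast
        show "node g (T j)" using n b by (rule step)
        show "S j \<subseteq>\<^sub>m T j" using block_ext[OF node_Short[OF n] b] ..
      qed
      have mono: "T k \<subseteq>\<^sub>m T j" if "j \<in> underS i" "k \<in> underS j" for j k
        using map_le_trans[OF IH(2)[OF that] TS(2)[OF that(1)]] .
      have sub: "T j \<subseteq>\<^sub>m S i" if j: "j \<in> underS i" for j
        unfolding S[of i]
      proof (rule map_le_map_Union)
        show "T j \<in> T ` underS i" using j by simp
        fix m assume "m \<in> T ` underS i"
        then obtain k where k: "k \<in> underS i" "m = T k" by blast
        have "j = k \<or> j \<in> underS k \<or> k \<in> underS j"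
          using underS_total[of j k] j k(1) underS_sub[of i] by blast
        then show "T j \<subseteq>\<^sub>m m \<or> m \<subseteq>\<^sub>m T j" using mono j k by auto
      qed
      have "S i \<in> Short"
        using UN_Short[OF card_of_underS[OF Card i], of T] node_Short[OF TS(1)] by (simp add: Short_iff domS)
      then have "node g (S i)"
      proof (rule limit)
        fix p assume "p \<in> dom (S i)"
        then obtain j where "j \<in> underS i" "p \<in> dom (T j)" unfolding domS by blast
        then show "\<exists>\<rho>. node g \<rho> \<and> \<rho> \<subseteq>\<^sub>m S i \<and> p \<in> dom \<rho>" using sub TS(1) by blast
      qed
      then show "node g (S i) \<and> (\<forall>j\<in>underS i. T j \<subseteq>\<^sub>m S i)" using sub by blast
    qed
  qed
  have SS: "S i \<in> Short" if "i \<in> Field \<kappa>" for i using inv that node_Short by blast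
  have ST: "S i \<subseteq>\<^sub>m T i" if "i \<in> Field \<kappa>" for i using T[OF that SS[OF that]] block_ext[OF SS[OF that]] by blast
  have TS: "T j \<subseteq>\<^sub>m S i" if "i \<in> Field \<kappa>" "j \<in> underS i" for i j using inv that by blast
  \<comment> \<open>Every block adds a position beyond its node, so stage \<open>i\<close> reaches
    position \<open>i\<close> and the union of all stages is total.\<close>
  have iT: "i \<in> Field \<kappa> \<longrightarrow> i \<in> dom (T i)" for i
  proof (induction i rule: well_order_induct)
    case (1 i)
    show ?case
    proof
      assume i: "i \<in> Field \<kappa>"
      then obtain \<gamma> where b: "block g (S i) \<gamma> (T i)" using T SS by blast
      have "underS i \<subseteq> dom (S i)"
        using 1 underS_sub[of i] unfolding domS underS_def by blast
      then have "g \<gamma> \<notin> underS i" and "g \<gamma> \<in> dom (T i)" using block_ext[OF SS[OF i] b] by blast+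
      moreover have "g \<gamma> \<in> Field \<kappa>"
        using \<open>g \<gamma> \<in> dom (T i)\<close> block_Short[OF b] by (auto simp: Short_iff ofilter_def)
      ultimately have "i \<in> under (g \<gamma>)"
        using i underS_total[of i "g \<gamma>"] mem_under[of "g \<gamma>" i] by auto
      then show "i \<in> dom (T i)" using b by (simp add: block_def)
    qed
  qed
  define x where "x = map_Union (T ` Field \<kappa>)"
  have Tx: "T i \<subseteq>\<^sub>m x" if i: "i \<in> Field \<kappa>" for i
    unfolding x_def
  proof (rule map_le_map_Union)
    show "T i \<in> T ` Field \<kappa>" using i by simp
    fix m assume "m \<in> T ` Field \<kappa>"
    then obtain k where k: "k \<in> Field \<kappa>" "m = T k" by blast
    have "i = k \<or> i \<in> underS k \<or> k \<in> underS i"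
      using underS_total[of i k] i k(1) by blast
    then show "T i \<subseteq>\<^sub>m m \<or> m \<subseteq>\<^sub>m T i"
      using map_le_trans[OF TS ST] i k by auto
  qed
  have Sx: "S i \<subseteq>\<^sub>m x" if "i \<in> Field \<kappa>" for i using map_le_trans[OF ST[OF that] Tx[OF that]] .
  have "dom (T i) \<subseteq> Field \<kappa>" if "i \<in> Field \<kappa>" for i
  proof -
    have "T i \<in> Short" using T[OF that SS[OF that]] block_Short by blast
    then show ?thesis by (simp add: Short_iff ofilter_def)
  qed
  then have "(\<Union>i\<in>Field \<kappa>. dom (T i)) = Field \<kappa>" using iT by blast
  then have x: "x \<in> cantor_space \<kappa>"
    by (simp add: cantor_space_def binseqs_def x_def dom_map_Union)
  have lt: "j \<in> underS k" if "j \<in> Field \<kappa>" "k \<in> Field \<kappa>" "p \<in> dom (S k)" "p \<notin> dom (S j)" for j k p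
  proof (rule ccontr)
    assume "j \<notin> underS k"
    then have "k = j \<or> k \<in> underS j" using that underS_total[of j k] by blast
    then have "dom (S k) \<subseteq> dom (S j)"
      using map_le_implies_dom_le[OF map_le_trans[OF ST TS], of k j] that by auto
    then show False using that by blast
  qed
  have nodes: "\<sigma> \<subseteq>\<^sub>m x \<longrightarrow> (\<exists>i\<in>Field \<kappa>. \<sigma> = S i)" if "node g \<sigma>" for \<sigma>
    using that
  proof induction
    case (limit \<sigma>)
    show ?case
    proof
      assume \<sigma>x: "\<sigma> \<subseteq>\<^sub>m x"
      have cover: "\<exists>k\<in>Field \<kappa>. S k \<subseteq>\<^sub>m \<sigma> \<and> p \<in> dom (S k)" if "p \<in> dom \<sigma>" for p
        using limit(2)[OF that] map_le_trans[OF _ \<sigma>x] by blast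
      obtain \<alpha> where \<alpha>: "\<alpha> \<in> Field \<kappa>" "dom \<sigma> = underS \<alpha>" using limit(1) by (rule ShortE)
      \<comment> \<open>The least stage covering \<open>\<sigma>\<close> equals it: an earlier
        \<open>S j\<close> misses some position of \<open>\<sigma>\<close>, which lies in a later
        stage \<open>S k\<close> below \<open>\<sigma>\<close>, and \<open>S k\<close> extends
        \<open>T j\<close>.\<close>
      define J where "J = {i \<in> Field \<kappa>. dom \<sigma> \<subseteq> dom (S i)}"
      have "underS \<alpha> \<subseteq> dom (S \<alpha>)"
        using iT underS_sub[of \<alpha>] unfolding domS by blast
      then have "J \<noteq> {}" "J \<subseteq> Field \<kappa>" using \<alpha> by (auto simp: J_def)
      define i where "i = minim J"
      have i: "i \<in> Field \<kappa>" "dom \<sigma> \<subseteq> dom (S i)"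
        using minim_in[OF \<open>J \<subseteq> Field \<kappa>\<close> \<open>J \<noteq> {}\<close>] by (auto simp: i_def J_def)
      have "dom (T j) \<subseteq> dom \<sigma>" if j: "j \<in> underS i" for j
      proof -
        have jF: "j \<in> Field \<kappa>" using j underS_sub by blast
        have "j \<notin> J"
          using minim_least[OF \<open>J \<subseteq> Field \<kappa>\<close>, of j] j underS_asym[of j i] ANTISYM
          by (auto simp: i_def underS_def antisym_def)
        then obtain p where p: "p \<in> dom \<sigma>" "p \<notin> dom (S j)" using jF by (auto simp: J_def)
        obtain k where k: "k \<in> Field \<kappa>" "S k \<subseteq>\<^sub>m \<sigma>" "p \<in> dom (S k)" using cover[OF p(1)] by blast
        have "T j \<subseteq>\<^sub>m S k" using TS[OF k(1) lt[OF jF k(1,3) p(2)]] .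
        from map_le_implies_dom_le[OF map_le_trans[OF this k(2)]] show ?thesis .
      qed
      then have "dom (S i) \<subseteq> dom \<sigma>" by (auto simp: domS)
      then have "\<sigma> = S i" using i \<sigma>x Sx map_le_common_eq[of \<sigma> x "S i"] by auto
      then show "\<exists>i\<in>Field \<kappa>. \<sigma> = S i" using i(1) by blast
    qed
  next
    case (step \<sigma> \<gamma> \<tau>)
    show ?case
    proof
      assume \<tau>x: "\<tau> \<subseteq>\<^sub>m x"
      have "\<sigma> \<subseteq>\<^sub>m \<tau>" using block_ext[OF node_Short[OF step(1)] step(2)] ..
      then have "\<sigma> \<subseteq>\<^sub>m x" using \<tau>x by (rule map_le_trans)
      then obtain i where i: "i \<in> Field \<kappa>" "\<sigma> = S i" using step by blast
      have "\<tau> = T i"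
        using block_unique[OF SS[OF i(1)] step(2)[unfolded i(2)] _ \<tau>x Tx[OF i(1)]] T[OF i(1) SS[OF i(1)]]
        by blast
      \<comment> \<open>\<open>i'\<close> is the successor of \<open>i\<close>, so
        \<open>T i\<close> is the largest map in the union \<open>S i'\<close>.\<close>
      obtain i' where i': "i' \<in> Field \<kappa>" "under i = underS i'" using under_eq_underS by blast
      have "i \<in> underS i'" using mem_under[OF i(1), of i] i'(2) by simp
      have "T j \<subseteq>\<^sub>m T i" if "j \<in> underS i'" for j
        using map_le_trans[OF TS ST, OF i(1) _ i(1)] that mem_under[OF i(1), of j] i'(2) by auto
      then have "S i' \<subseteq>\<^sub>m T i" unfolding S[of i'] by (intro map_Union_map_le) auto
      then have "T i = S i'" using TS[OF i'(1) \<open>i \<in> underS i'\<close>] map_le_antisym by blast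
      then show "\<exists>i\<in>Field \<kappa>. \<tau> = S i" using \<open>\<tau> = T i\<close> i'(1) by blast
    qed
  qed
  have "x \<in> Blocks g"
    unfolding Blocks_def
  proof (intro CollectI conjI allI impI x)
    fix \<sigma> assume "node g \<sigma>" "\<sigma> \<subseteq>\<^sub>m x"
    then obtain i where i: "i \<in> Field \<kappa>" "\<sigma> = S i" using nodes by blast
    then show "\<exists>\<gamma> \<tau>. block g \<sigma> \<gamma> \<tau> \<and> \<tau> \<subseteq>\<^sub>m x" using T[OF i(1) SS] Tx by blast
  qed
  moreover have "x \<notin> A i" if "i \<in> Field \<kappa>" for i
    using T[OF that SS[OF that]] Tx[OF that] x unfolding basic_clopen_def by blast
  ultimately show ?thesis by blast
qed

end

section \<open>Definition and verification of the two maps\<close>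

theorem theorem2p1:
  fixes \<kappa> :: "'a rel" and lam :: "'b rel"
  assumes "Card_order \<kappa>" and "regularCard \<kappa>" and "natLeq <o \<kappa>"
    and "Card_order lam" and "lam =o |short_binseqs \<kappa>|"
  shows "\<exists>\<Phi>_minus \<Phi>_plus.
    \<Phi>_minus \<in> fun_space \<kappa> lam \<rightarrow> NWD \<kappa> \<and>
    \<Phi>_plus \<in> meager \<kappa> \<rightarrow> subsets_of_card (fun_space \<kappa> lam) lam \<and>
    (\<forall>A\<in>meager \<kappa>. \<forall>g\<in>fun_space \<kappa> lam.
       \<not> (\<exists>f\<in>\<Phi>_plus A. le_star \<kappa> lam g f) \<longrightarrow> \<not> \<Phi>_minus g \<subseteq> A)"
proof -
  have \<kappa>_iso: "|Field \<kappa>| =o \<kappa>" using assms(1) by (rule card_of_Field_ordIso)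
  have "natLeq \<le>o |Field \<kappa>|"
    using ordLeq_ordIso_trans[OF ordLess_imp_ordLeq[OF assms(3)] ordIso_symmetric[OF \<kappa>_iso]] .
  then have "infinite (Field \<kappa>)" using infinite_iff_natLeq_ordLeq by blast
  then interpret infinite_regular \<kappa>
    using assms(1,2) card_order_on_well_order_on by unfold_locales auto
  have "|Field lam| =o |Short|"
    using card_of_Field_ordIso[OF assms(4)] assms(5) by (rule ordIso_transitive)
  then obtain d where d: "bij_betw d (Field lam) Short"
    unfolding card_of_ordIso[symmetric] by blast
  have "\<forall>\<sigma>\<in>Short. \<exists>c. (\<forall>\<tau>\<in>Short. c \<tau> \<in> Short \<and> \<sigma> \<subseteq>\<^sub>m c \<tau>) \<and>
    (\<forall>\<tau>\<in>Short. \<forall>\<tau>'\<in>Short. \<forall>z. c \<tau> \<subseteq>\<^sub>m z \<longrightarrow> c \<tau>' \<subseteq>\<^sub>m z \<longrightarrow> \<tau> = \<tau>')"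
    using ex_antichain_above by blast
  from bchoice[OF this] obtain c0 where c0: "\<forall>\<sigma>\<in>Short. (\<forall>\<tau>\<in>Short. c0 \<sigma> \<tau> \<in> Short \<and> \<sigma> \<subseteq>\<^sub>m c0 \<sigma> \<tau>) \<and>
    (\<forall>\<tau>\<in>Short. \<forall>\<tau>'\<in>Short. \<forall>z. c0 \<sigma> \<tau> \<subseteq>\<^sub>m z \<longrightarrow> c0 \<sigma> \<tau>' \<subseteq>\<^sub>m z \<longrightarrow> \<tau> = \<tau>')"
    by blast
  \<comment> \<open>The bijection \<open>d\<close> reindexes each antichain from
    \<open>Short\<close> to \<open>lam\<close>.\<close>
  define c where "c \<sigma> \<gamma> = c0 \<sigma> (d \<gamma>)" for \<sigma> \<gamma>
  have d_in: "d \<gamma> \<in> Short" if "\<gamma> \<in> Field lam" for \<gamma> using d that by (rule bij_betwE[rule_format])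
  interpret coding \<kappa> "Field lam" c
  proof
    fix \<sigma> \<gamma> assume "\<sigma> \<in> Short" "\<gamma> \<in> Field lam"
    then show "c \<sigma> \<gamma> \<in> Short" "\<sigma> \<subseteq>\<^sub>m c \<sigma> \<gamma>" using c0 d_in by (auto simp: c_def)
  next
    fix \<sigma> \<gamma> \<gamma>' z
    assume *: "\<sigma> \<in> Short" "\<gamma> \<in> Field lam" "\<gamma>' \<in> Field lam" "c \<sigma> \<gamma> \<subseteq>\<^sub>m z" "c \<sigma> \<gamma>' \<subseteq>\<^sub>m z"
    have "d \<gamma> = d \<gamma>'" using c0[rule_format, OF *(1)] d_in * unfolding c_def by blast
    then show "\<gamma> = \<gamma>'" using inj_onD[OF bij_betw_imp_inj_on[OF d]] *(2,3) by blast
  qed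
  \<comment> \<open>The constant sequences, one of each length, give \<kappa> \<le>
    \<open>lam\<close>, which later bounds the number of pairs of a node and an index.\<close>
  have "inj_on (\<lambda>\<alpha> p. if p \<in> underS \<alpha> then Some True else None) (Field \<kappa>)"
  proof (rule inj_onI)
    fix \<alpha> \<beta> assume "\<alpha> \<in> Field \<kappa>" "\<beta> \<in> Field \<kappa>" and
      eq: "(\<lambda>p. if p \<in> underS \<alpha> then Some True else None) = (\<lambda>p. if p \<in> underS \<beta> then Some True else None)"
    have "p \<in> underS \<alpha> \<longleftrightarrow> p \<in> underS \<beta>" for p using fun_cong[OF eq, of p] by (simp split: if_splits)
    then show "\<alpha> = \<beta>"
      using underS_total[OF \<open>\<alpha> \<in> Field \<kappa>\<close> \<open>\<beta> \<in> Field \<kappa>\<close>] underS_notIn[of _ \<kappa>] by blast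
  qed
  moreover have "(\<lambda>p. if p \<in> underS \<alpha> then Some True else None) \<in> Short" if "\<alpha> \<in> Field \<kappa>" for \<alpha>
    using that by (rule Short_underS) (auto simp: dom_def)
  ultimately have "|Field \<kappa>| \<le>o |Short|" by (rule card_of_ordLeqI)
  then have \<kappa>_lam: "|Field \<kappa>| \<le>o lam"
    using ordLeq_ordIso_trans ordIso_symmetric[OF assms(5)] by blast
  have lam_inf: "infinite (Field lam)"
  proof
    assume "finite (Field lam)"
    moreover have "|Field \<kappa>| \<le>o |Field lam|"
      using \<kappa>_lam ordIso_symmetric[OF card_of_Field_ordIso[OF assms(4)]] by (rule ordLeq_ordIso_trans)
    ultimately show False using card_of_ordLeq_finite infinite_Field by blast
  qed
  obtain a where a: "a \<in> Field \<kappa>" using infinite_imp_nonempty[OF infinite_Field] by blast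
  obtain b where b: "b \<in> Field \<kappa>" "a \<noteq> b"
    using infinite_Card_order_limit[OF assms(1) infinite_Field a] by blast
  \<comment> \<open>\<open>P\<close> pads \<open>\<Phi>_plus A\<close> to cardinality exactly \<open>lam\<close>.\<close>
  define P where "P = (\<lambda>\<gamma>. \<lambda>\<delta>\<in>Field lam. if \<delta> = \<gamma> then a else b) ` Field lam"
  have "inj_on (\<lambda>\<gamma>. \<lambda>\<delta>\<in>Field lam. if \<delta> = \<gamma> then a else b) (Field lam)"
  proof (rule inj_onI)
    fix \<gamma> \<gamma>' assume \<gamma>: "\<gamma> \<in> Field lam" and
      eq: "(\<lambda>\<delta>\<in>Field lam. if \<delta> = \<gamma> then a else b) = (\<lambda>\<delta>\<in>Field lam. if \<delta> = \<gamma>' then a else b)"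
    show "\<gamma> = \<gamma>'" using fun_cong[OF eq, of \<gamma>] \<gamma> b(2) by (simp split: if_splits)
  qed
  then have "|Field lam| =o |P|"
    unfolding P_def using card_of_ordIso inj_on_imp_bij_betw by blast
  then have P: "|P| =o lam"
    using ordIso_transitive ordIso_symmetric card_of_Field_ordIso[OF assms(4)] by blast
  have P_sub: "P \<subseteq> fun_space \<kappa> lam" using a b by (auto simp: P_def fun_space_def)
  have empty_NWD: "{} \<in> NWD \<kappa>" unfolding NWD_def using map_le_refl by blast
  have "\<exists>B. (\<forall>i\<in>Field \<kappa>. B i \<in> NWD \<kappa>) \<and> A \<subseteq> (\<Union>i\<in>Field \<kappa>. B i)" if "A \<in> meager \<kappa>" for A
  proof -
    obtain F where F: "F \<subseteq> NWD \<kappa>" "|F| \<le>o \<kappa>" "A = \<Union>F" using \<open>A \<in> meager \<kappa>\<close> by (auto simp: meager_def)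
    show ?thesis
    \<comment> \<open>The empty family is not an image of the nonempty field; the constant
      enumeration by the empty set covers its union.\<close>
    proof (cases "F = {}")
      case True
      then show ?thesis using F(3) empty_NWD by (intro exI[of _ "\<lambda>_. {}"]) simp
    next
      case False
      have "|F| \<le>o |Field \<kappa>|" using F(2) ordIso_symmetric[OF \<kappa>_iso] by (rule ordLeq_ordIso_trans)
      from iffD2[OF card_of_ordLeq2[OF False] this] obtain B where "B ` Field \<kappa> = F" ..
      then show ?thesis using F by (intro exI[of _ B]) auto
    qed
  qed
  then obtain B where B: "\<And>A. A \<in> meager \<kappa> \<Longrightarrow> (\<forall>i\<in>Field \<kappa>. B A i \<in> NWD \<kappa>) \<and> A \<subseteq> (\<Union>i\<in>Field \<kappa>. B A i)"
    by metis
  define h where "h D \<rho> = (SOME \<tau>. \<tau> \<in> Short \<and> \<rho> \<subseteq>\<^sub>m \<tau> \<and> basic_clopen \<kappa> \<tau> \<inter> D = {})" for D \<rho>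
  have h: "h D \<rho> \<in> Short \<and> \<rho> \<subseteq>\<^sub>m h D \<rho> \<and> basic_clopen \<kappa> (h D \<rho>) \<inter> D = {}"
    if "D \<in> NWD \<kappa>" "\<rho> \<in> Short" for D \<rho>
  proof -
    have "\<exists>\<tau>. \<tau> \<in> Short \<and> \<rho> \<subseteq>\<^sub>m \<tau> \<and> basic_clopen \<kappa> \<tau> \<inter> D = {}"
      using that unfolding NWD_def by blast
    then show ?thesis unfolding h_def by (rule someI_ex)
  qed
  have "\<forall>\<rho>\<in>Short. \<exists>\<alpha>. \<alpha> \<in> Field \<kappa> \<and> dom \<rho> = underS \<alpha>"
    by (auto simp: short_binseqs_def binseqs_def)
  from bchoice[OF this] obtain len where len: "\<And>\<rho>. \<rho> \<in> Short \<Longrightarrow> len \<rho> \<in> Field \<kappa> \<and> dom \<rho> = underS (len \<rho>)"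
    by blast
  define f where "f A \<sigma> i = (\<lambda>\<gamma>\<in>Field lam. len (h (B A i) (c \<sigma> \<gamma>)))" for A \<sigma> i
  define Q where "Q A = (\<lambda>(\<sigma>, i). f A \<sigma> i) ` (Short \<times> Field \<kappa>) \<union> P" for A
  have "Q A \<in> subsets_of_card (fun_space \<kappa> lam) lam" if A: "A \<in> meager \<kappa>" for A
  proof -
    have "f A \<sigma> i \<in> fun_space \<kappa> lam" if "\<sigma> \<in> Short" "i \<in> Field \<kappa>" for \<sigma> i
      using len h B[OF A] c_Short that by (auto simp: f_def fun_space_def)
    then have "Q A \<subseteq> fun_space \<kappa> lam" using P_sub by (auto simp: Q_def)
    moreover have "|Q A| =o lam"
    proof -
      \<comment> \<open>The pairs \<open>(\<sigma>, i)\<close> give the upper bound for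
        \<open>Q A\<close>, the padding \<open>P\<close> the lower one.\<close>
      have "|Short \<times> Field \<kappa>| \<le>o lam"
        using \<kappa>_lam ordIso_imp_ordLeq[OF ordIso_symmetric[OF assms(5)]] lam_inf assms(4)
        by (intro card_of_Times_ordLeq_infinite_Field)
      then have "|Q A| \<le>o lam"
        unfolding Q_def using P lam_inf assms(4) ordLeq_transitive[OF card_of_image]
        by (intro card_of_Un_ordLeq_infinite_Field ordIso_imp_ordLeq[OF P]) auto
      moreover have "|P| \<le>o |Q A|" by (rule card_of_mono1) (simp add: Q_def)
      then have "lam \<le>o |Q A|" using ordIso_ordLeq_trans[OF ordIso_symmetric[OF P]] by blast
      ultimately show ?thesis by (simp add: ordIso_iff_ordLeq)
    qed
    ultimately show ?thesis by (simp add: subsets_of_card_def)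
  qed
  moreover have "\<not> Blocks g \<subseteq> A"
    if A: "A \<in> meager \<kappa>" and g: "g \<in> fun_space \<kappa> lam" and unb: "\<not> (\<exists>f\<in>Q A. le_star \<kappa> lam g f)" for A g
  proof -
    have gF: "g \<in> Field lam \<rightarrow> Field \<kappa>" using g by (auto simp: fun_space_def)
    have "\<exists>x\<in>Blocks g. \<forall>i\<in>Field \<kappa>. x \<notin> B A i"
    proof (rule ex_escape)
      fix i \<sigma> assume i: "i \<in> Field \<kappa>" and \<sigma>: "\<sigma> \<in> Short"
      have "\<not> le_star \<kappa> lam g (f A \<sigma> i)" using unb i \<sigma> by (auto simp: Q_def)
      \<comment> \<open>The empty set has size below \<kappa>, so the exceptional set is nonempty;
        one \<open>\<gamma>\<close> where \<open>g\<close> exceeds \<open>f A \<sigma> i\<close>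
        yields the next block.\<close>
      moreover have "|{}| <o \<kappa>"
        using card_of_empty card_of_underS[OF Card i] by (rule ordLeq_ordLess_trans)
      ultimately obtain \<gamma> where \<gamma>: "\<gamma> \<in> Field lam" "f A \<sigma> i \<gamma> \<in> underS (g \<gamma>)"
        unfolding le_star_def by (metis (mono_tags, lifting) empty_Collect_eq)
      have "h (B A i) (c \<sigma> \<gamma>) \<in> Short" using h B[OF A] i c_Short[OF \<sigma> \<gamma>(1)] by blast
      then have "dom (h (B A i) (c \<sigma> \<gamma>)) = underS (f A \<sigma> i \<gamma>)"
        using len \<gamma>(1) by (simp add: f_def)
      moreover have "underS (f A \<sigma> i \<gamma>) \<subseteq> underS (g \<gamma>)"
        using \<gamma>(2) TRANS ANTISYM by (auto simp: underS_def dest: transD antisymD)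
      ultimately have "\<exists>\<gamma>\<in>Field lam. dom (h (B A i) (c \<sigma> \<gamma>)) \<subseteq> underS (g \<gamma>)" using \<gamma>(1) by auto
      then show "\<exists>\<tau> \<gamma>. block g \<sigma> \<gamma> \<tau> \<and> basic_clopen \<kappa> \<tau> \<inter> B A i = {}"
        using h B[OF A] \<sigma> i by (intro ex_escape_step[OF gF, of "\<lambda>i. h (B A i)"]) auto
    qed
    then show ?thesis using B[OF A] by blast
  qed
  ultimately show ?thesis
    using Blocks_NWD by (intro exI[of _ Blocks] exI[of _ Q]) auto
qed

end
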